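(* Let $v$ be a weight on $(0,\infty)$ belonging to both classes $M_1^*$ and $m_1^*$. A measurable function $h:(0,\infty)\to\mathbb{R}$ belongs to $\mathrm{Cop}_1(v)$ if and only if it admits a factorization $h=f\cdot g$ with $f\in L^1(v)$ and $g\in L^\infty$. Moreover, for every such $h$, $$[v]_{m_1^*}\,N(h)\le\|h\|_{\mathrm{Cop}_1(v)}\le[v]_{M_1^*}\,N(h),$$ where $N(h)=\inf\|f\|_{L^1(v)}\|g\|_\infty$, the infimum being taken over all factorizations $h=f\cdot g$ with $f\in L^1(v)$ and $g\in L^\infty$. The constants are optimal, i.e. $[v]_{m_1^*}$ cannot be replaced by a larger constant and $[v]_{M_1^*}$ cannot be replaced by a smaller constant, if the inequalities are to hold for all $h\in\mathrm{Cop}_1(v)$.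
   Context: All functions are real-valued and Lebesgue measurable on $(0,\infty)$; equalities between functions are a.e. A weight is a function $v$ that is positive a.e. and locally integrable on $(0,\infty)$. $\|f\|_{L^1(v)}=\int_0^\infty|f(x)|v(x)\,dx$, and $\|g\|_\infty=\operatorname{ess\,sup}_{x>0}|g(x)|$. $\mathrm{Cop}_1(v)$ is the set of functions $f$ with $$\|f\|_{\mathrm{Cop}_1(v)}=\int_0^\infty\left(\int_t^\infty\frac{|f(x)|}{x}\,dx\right)v(t)\,dt<\infty.$$ The class $M_1^*$ consists of the weights $v$ for which there is a constant $C>0$ such that $\frac1t\int_0^t v(x)\,dx\le C\,v(t)$ for almost every $t>0$; $[v]_{M_1^*}$ is the least such $C$. The class $m_1^*$ consists of the weights $v$ for which the reverse inequality $\frac1t\int_0^t v(x)\,dx\ge C\,v(t)$ holds for almost every $t>0$ with some constant $C>0$; $[v]_{m_1^*}$ is the largest such $C$. *)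

theory Defs
  imports "HOL-Analysis.Analysis" "HOL-Probability.Essential_Supremum"
begin

text \<open>
  A function on $(0,\infty)$ is represented by a function of type \<open>real \<Rightarrow> real\<close>; its values outside
  \<open>{0<..}\<close> never matter. Norms take values in \<open>ennreal\<close>, so that they are defined for all measurable
  functions and finiteness is membership in the corresponding space.
\<close>

abbreviation halfline :: "real measure" where
  "halfline \<equiv> lebesgue_on {0<..}"

definition weight :: "(real \<Rightarrow> real) \<Rightarrow> bool" where
  "weight v \<longleftrightarrow>
     v \<in> borel_measurable halfline \<and>
     (AE x in halfline. 0 < v x) \<and>
     (\<forall>K. compact K \<and> K \<subseteq> {0<..} \<longrightarrow> set_integrable lebesgue K v)"

definition L1_norm :: "(real \<Rightarrow> real) \<Rightarrow> (real \<Rightarrow> real) \<Rightarrow> ennreal" where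
  "L1_norm v f = (\<integral>\<^sup>+x. ennreal (\<bar>f x\<bar> * v x) \<partial>halfline)"

definition L1_space :: "(real \<Rightarrow> real) \<Rightarrow> (real \<Rightarrow> real) set" where
  "L1_space v = {f \<in> borel_measurable halfline. L1_norm v f < \<infinity>}"

definition Linf_norm :: "(real \<Rightarrow> real) \<Rightarrow> ennreal" where
  "Linf_norm g = esssup halfline (\<lambda>x. ennreal \<bar>g x\<bar>)"

definition Linf_space :: "(real \<Rightarrow> real) set" where
  "Linf_space = {g \<in> borel_measurable halfline. Linf_norm g < \<infinity>}"

definition Cop1_norm :: "(real \<Rightarrow> real) \<Rightarrow> (real \<Rightarrow> real) \<Rightarrow> ennreal" where
  "Cop1_norm v f =
     (\<integral>\<^sup>+t. (\<integral>\<^sup>+x. ennreal (\<bar>f x\<bar> / x) \<partial>lebesgue_on {t<..}) * ennreal (v t) \<partial>halfline)"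

definition Cop1 :: "(real \<Rightarrow> real) \<Rightarrow> (real \<Rightarrow> real) set" where
  "Cop1 v = {f \<in> borel_measurable halfline. Cop1_norm v f < \<infinity>}"

text \<open>
  The average is taken in \<open>ennreal\<close> because local integrability on the open half-line does not
  exclude that the integral of a weight over $(0,t)$ is infinite.
\<close>

definition average :: "(real \<Rightarrow> real) \<Rightarrow> real \<Rightarrow> ennreal" where
  "average v t = ennreal (1 / t) * (\<integral>\<^sup>+x. ennreal (v x) \<partial>lebesgue_on {0<..<t})"

definition M1star_bound :: "(real \<Rightarrow> real) \<Rightarrow> real \<Rightarrow> bool" where
  "M1star_bound v C \<longleftrightarrow> 0 < C \<and> (AE t in halfline. average v t \<le> ennreal (C * v t))"

definition m1star_bound :: "(real \<Rightarrow> real) \<Rightarrow> real \<Rightarrow> bool" where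
  "m1star_bound v C \<longleftrightarrow> 0 < C \<and> (AE t in halfline. average v t \<ge> ennreal (C * v t))"

definition M1star :: "(real \<Rightarrow> real) set" where
  "M1star = {v. weight v \<and> (\<exists>C. M1star_bound v C)}"

definition m1star :: "(real \<Rightarrow> real) set" where
  "m1star = {v. weight v \<and> (\<exists>C. m1star_bound v C)}"

definition M1star_const :: "(real \<Rightarrow> real) \<Rightarrow> real" where
  "M1star_const v = (LEAST C. M1star_bound v C)"

text \<open>
  A greatest constant need not exist for \<open>v \<in> m1star\<close> alone (the averages may be infinite); it does
  for \<open>v \<in> M1star \<inter> m1star\<close>.
\<close>

definition m1star_const :: "(real \<Rightarrow> real) \<Rightarrow> real" where
  "m1star_const v = (GREATEST C. m1star_bound v C)"

definition factorization ::
  "(real \<Rightarrow> real) \<Rightarrow> (real \<Rightarrow> real) \<Rightarrow> (real \<Rightarrow> real) \<Rightarrow> (real \<Rightarrow> real) \<Rightarrow> bool" where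
  "factorization v h f g \<longleftrightarrow>
     f \<in> L1_space v \<and> g \<in> Linf_space \<and> (AE x in halfline. h x = f x * g x)"

definition factor_norm :: "(real \<Rightarrow> real) \<Rightarrow> (real \<Rightarrow> real) \<Rightarrow> ennreal" where
  "factor_norm v h = Inf {L1_norm v f * Linf_norm g | f g. factorization v h f g}"

end

theory Submission
  imports Defs
begin

text \<open>
  By Tonelli's theorem the Copson norm is itself a weighted \<open>L\<^sup>1\<close> norm, whose weight is the average
  \<open>A t = (1/t) * \<integral>\<^sub>0\<^sup>t v\<close>: exchanging the two integrals gives
  \<open>\<integral> (\<integral>\<^sub>t\<^sup>\<infinity> \<bar>h x\<bar> / x dx) v t dt = \<integral> \<bar>h x\<bar> * A x dx\<close> (\<open>Cop1_norm_eq_average\<close>). On the other side,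
  the factorization norm is the norm of \<open>L\<^sup>1(v)\<close>: the factorization \<open>h = h * 1\<close> is optimal,
  since \<open>\<integral> \<bar>f g\<bar> v \<le> \<parallel>g\<parallel>\<^sub>\<infinity> \<integral> \<bar>f\<bar> v\<close> (\<open>factor_norm_eq_L1_norm\<close>).

  The theorem therefore compares the weights \<open>A\<close> and \<open>v\<close>. The two class conditions say exactly
  \<open>c * v \<le> A \<le> C * v\<close> almost everywhere, and integrating against \<open>\<bar>h\<bar>\<close> gives both the identity of
  the spaces and the two norm inequalities. Conversely, an inequality of norms with constant \<open>c\<close>,
  tested on indicator functions of sets that stay away from \<open>0\<close> and \<open>\<infinity>\<close>, forces the
  corresponding pointwise inequality almost everywhere (\<open>AE_le_of_indicator_integrals_le\<close>), so that
  \<open>c\<close> is admissible in the definition of the class; hence the extremal admissible constants are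
  optimal. These are attained (\<open>M1star_const_least\<close>, \<open>m1star_const_greatest\<close>) because every
  admissible \<open>c\<close> is at most every admissible \<open>C\<close>, so that the infimum of the \<open>C\<close> is positive and
  the supremum of the \<open>c\<close> is finite, and because the two inequalities survive countable limits.
\<close>

section \<open>The Copson norm as a weighted integral\<close>

lemma sets_halfline_ray: "{a<..} \<inter> {0<..} \<in> sets halfline" "{..<a} \<inter> {0<..} \<in> sets halfline"
  for a :: real
  by (simp_all add: sets_restrict_space_iff)

lemma id_measurable_halfline [measurable]: "(\<lambda>x. x) \<in> borel_measurable halfline"
  by (intro measurable_restrict_space1 measurable_completion) simp

lemma Icc_inverse_nat_halfline:
  "{1 / (real n + 1)..real n + 1} \<subseteq> {0<..}"
  "{1 / (real n + 1)..real n + 1} \<in> sets halfline"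
proof -
  show sub: "{1 / (real n + 1)..real n + 1} \<subseteq> {0<..}"
  proof
    fix x assume "x \<in> {1 / (real n + 1)..real n + 1}"
    moreover have "0 < 1 / (real n + 1)" by simp
    ultimately show "x \<in> {0<..}" unfolding atLeastAtMost_iff greaterThan_iff by linarith
  qed
  show "{1 / (real n + 1)..real n + 1} \<in> sets halfline"
    using sub by (subst sets_restrict_space_iff) auto
qed

lemma halfline_exhaustion:
  assumes "0 < (x::real)"
  obtains n where "x \<in> {1 / (real n + 1)..real n + 1}"
proof -
  obtain n where n: "max x (1 / x) < real n"
    using reals_Archimedean2 by blast
  have "1 / x < real n + 1" using n by linarith
  then have "1 / (real n + 1) \<le> x"
    using assms by (simp add: field_simps)
  then show thesis using that[of n] n by auto
qed

lemma sigma_finite_halfline: "sigma_finite_measure halfline"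
proof
  let ?K = "\<lambda>n. {1 / (real n + 1)..real n + 1}"
  have "\<Union> (range ?K) = {0<..}"
  proof (intro equalityI subsetI)
    fix x :: real assume "x \<in> {0<..}"
    then obtain n where "x \<in> ?K n" using halfline_exhaustion[of x] by auto
    then show "x \<in> \<Union> (range ?K)" by (intro UN_I[of n]) simp_all
  qed (use Icc_inverse_nat_halfline(1) in blast)
  moreover have "emeasure halfline (?K n) \<noteq> \<infinity>" for n
    using Icc_inverse_nat_halfline(1)[of n]
    by (subst emeasure_restrict_space) (simp_all add: emeasure_lborel_Icc_eq)
  ultimately show "\<exists>A. countable A \<and> A \<subseteq> sets halfline \<and> \<Union> A = space halfline \<and>
      (\<forall>a\<in>A. emeasure halfline a \<noteq> \<infinity>)"
    using Icc_inverse_nat_halfline(2)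
    by (intro exI[of _ "range ?K"]) auto
qed

lemma nn_integral_halfline_tail:
  assumes "0 < t"
  shows "(\<integral>\<^sup>+x. F x \<partial>lebesgue_on {t<..}) = (\<integral>\<^sup>+x. F x * indicator {t<..} x \<partial>halfline)"
  using assms
  by (subst (1 2) nn_integral_restrict_space)
     (auto intro!: nn_integral_cong split: split_indicator)

lemma average_eq_halfline:
  "average v t = ennreal (1 / t) * (\<integral>\<^sup>+s. ennreal (v s) * indicator {..<t} s \<partial>halfline)"
proof -
  have "(\<integral>\<^sup>+x. ennreal (v x) \<partial>lebesgue_on {0<..<t})
      = (\<integral>\<^sup>+s. ennreal (v s) * indicator {..<t} s \<partial>halfline)"
    by (subst (1 2) nn_integral_restrict_space)
       (auto intro!: nn_integral_cong split: split_indicator)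
  then show ?thesis by (simp add: average_def)
qed

lemma less_pair_measurable_halfline:
  "(\<lambda>(x, t). indicator {t<..} x :: ennreal) \<in> borel_measurable (halfline \<Otimes>\<^sub>M halfline)"
proof -
  have [measurable]: "fst \<in> borel_measurable (halfline \<Otimes>\<^sub>M halfline)"
    "snd \<in> borel_measurable (halfline \<Otimes>\<^sub>M halfline)"
    using measurable_compose[OF measurable_fst id_measurable_halfline]
      measurable_compose[OF measurable_snd id_measurable_halfline] by auto
  have "(\<lambda>z. indicator {z. snd z < fst z} z :: ennreal) \<in> borel_measurable (halfline \<Otimes>\<^sub>M halfline)"
    by measurable
  then show ?thesis
    by (rule measurable_cong[THEN iffD1, rotated]) (auto split: split_indicator)
qed

lemma average_measurable [measurable]:
  assumes [measurable]: "v \<in> borel_measurable halfline"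
  shows "average v \<in> borel_measurable halfline"
proof -
  interpret sigma_finite_measure halfline by (rule sigma_finite_halfline)
  have "(\<lambda>(x, s). ennreal (v s) * indicator {s<..} x) \<in> borel_measurable (halfline \<Otimes>\<^sub>M halfline)"
    using less_pair_measurable_halfline by (simp add: case_prod_beta')
  then have "(\<lambda>x. ennreal (1 / x) * (\<integral>\<^sup>+s. ennreal (v s) * indicator {s<..} x \<partial>halfline))
      \<in> borel_measurable halfline"
    by measurable
  moreover have "average v =
      (\<lambda>x. ennreal (1 / x) * (\<integral>\<^sup>+s. ennreal (v s) * indicator {s<..} x \<partial>halfline))"
    by (auto simp: average_eq_halfline fun_eq_iff
        intro!: arg_cong2[where f = "(*)"] nn_integral_cong split: split_indicator)
  ultimately show ?thesis by simp
qed

text \<open>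
  Tonelli's theorem for \<open>(\<bar>h x\<bar> / x) * v t\<close> on the region \<open>0 < t < x\<close>: integrating in \<open>x\<close> first is the
  Copson norm, integrating in \<open>t\<close> first produces the average of \<open>v\<close> over \<open>(0, x)\<close>.
\<close>

lemma Cop1_norm_eq_average:
  assumes [measurable]: "v \<in> borel_measurable halfline" "h \<in> borel_measurable halfline"
  shows "Cop1_norm v h = (\<integral>\<^sup>+x. ennreal \<bar>h x\<bar> * average v x \<partial>halfline)"
proof -
  interpret sigma_finite_measure halfline by (rule sigma_finite_halfline)
  interpret P: pair_sigma_finite halfline halfline ..
  let ?w = "\<lambda>x t. ennreal (\<bar>h x\<bar> / x) * indicator {t<..} x * ennreal (v t)"
  have w: "case_prod ?w \<in> borel_measurable (halfline \<Otimes>\<^sub>M halfline)"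
    using less_pair_measurable_halfline by (simp add: case_prod_beta')
  have tail: "{t<..} \<inter> {0<..} \<in> sets halfline" for t :: real
    by (rule sets_halfline_ray)
  have ind: "(\<lambda>x. indicator {t<..} x :: ennreal) \<in> borel_measurable halfline" for t :: real
    using borel_measurable_indicator[OF tail[of t]]
    by (rule measurable_cong[THEN iffD1, rotated]) (auto split: split_indicator)
  have ind': "(\<lambda>t. indicator {t<..} x :: ennreal) \<in> borel_measurable halfline" for x :: real
    using borel_measurable_indicator[OF sets_halfline_ray(2)[of x]]
    by (rule measurable_cong[THEN iffD1, rotated]) (auto split: split_indicator)
  note [measurable] = ind ind'
  have "Cop1_norm v h = (\<integral>\<^sup>+t. (\<integral>\<^sup>+x. ?w x t \<partial>halfline) \<partial>halfline)"
    unfolding Cop1_norm_def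
  proof (rule nn_integral_cong)
    fix t assume "t \<in> space halfline"
    then have "0 < t" by simp
    then show "(\<integral>\<^sup>+x. ennreal (\<bar>h x\<bar> / x) \<partial>lebesgue_on {t<..}) * ennreal (v t)
        = (\<integral>\<^sup>+x. ?w x t \<partial>halfline)"
      by (subst nn_integral_multc) (simp_all add: nn_integral_halfline_tail)
  qed
  also have "\<dots> = (\<integral>\<^sup>+x. (\<integral>\<^sup>+t. ?w x t \<partial>halfline) \<partial>halfline)"
    using P.Fubini'[OF w] .
  also have "\<dots> = (\<integral>\<^sup>+x. ennreal \<bar>h x\<bar> * average v x \<partial>halfline)"
  proof (rule nn_integral_cong)
    fix x assume "x \<in> space halfline"
    then have x: "0 < x" by simp
    have "(\<integral>\<^sup>+t. ?w x t \<partial>halfline)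
        = (\<integral>\<^sup>+t. ennreal (\<bar>h x\<bar> / x) * (indicator {t<..} x * ennreal (v t)) \<partial>halfline)"
      by (simp add: mult.assoc)
    also have "\<dots> = ennreal (\<bar>h x\<bar> / x) * (\<integral>\<^sup>+t. indicator {t<..} x * ennreal (v t) \<partial>halfline)"
      by (rule nn_integral_cmult) measurable
    also have "(\<integral>\<^sup>+t. indicator {t<..} x * ennreal (v t) \<partial>halfline)
        = (\<integral>\<^sup>+t. ennreal (v t) * indicator {..<x} t \<partial>halfline)"
      by (auto intro!: nn_integral_cong split: split_indicator)
    finally have "(\<integral>\<^sup>+t. ?w x t \<partial>halfline)
        = ennreal (\<bar>h x\<bar> / x) * (\<integral>\<^sup>+t. ennreal (v t) * indicator {..<x} t \<partial>halfline)" .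
    moreover have "ennreal (\<bar>h x\<bar> / x) = ennreal \<bar>h x\<bar> * ennreal (1 / x)"
      using x by (simp flip: ennreal_mult)
    ultimately show "(\<integral>\<^sup>+t. ?w x t \<partial>halfline) = ennreal \<bar>h x\<bar> * average v x"
      by (simp only: average_eq_halfline mult.assoc)
  qed
  finally show ?thesis .
qed

section \<open>The factorization norm as a weighted integral\<close>

lemma L1_norm_eq: "L1_norm v h = (\<integral>\<^sup>+x. ennreal \<bar>h x\<bar> * ennreal (v x) \<partial>halfline)"
  by (simp add: L1_norm_def ennreal_mult')

lemma L1_norm_le_of_factorization:
  assumes [measurable]: "v \<in> borel_measurable halfline" and fac: "factorization v h f g"
  shows "L1_norm v h \<le> L1_norm v f * Linf_norm g"
proof -
  have [measurable]: "f \<in> borel_measurable halfline"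
    using fac by (simp add: factorization_def L1_space_def)
  have "AE x in halfline. ennreal \<bar>g x\<bar> \<le> Linf_norm g"
    unfolding Linf_norm_def by (rule esssup_AE)
  moreover have "AE x in halfline. h x = f x * g x"
    using fac by (simp add: factorization_def)
  ultimately have "AE x in halfline.
      ennreal \<bar>h x\<bar> * ennreal (v x) \<le> (ennreal \<bar>f x\<bar> * ennreal (v x)) * Linf_norm g"
  proof eventually_elim
    case (elim x)
    have "ennreal \<bar>h x\<bar> * ennreal (v x) = (ennreal \<bar>f x\<bar> * ennreal (v x)) * ennreal \<bar>g x\<bar>"
      using elim by (simp add: abs_mult ennreal_mult mult_ac)
    also have "\<dots> \<le> (ennreal \<bar>f x\<bar> * ennreal (v x)) * Linf_norm g"
      using elim by (intro mult_left_mono) auto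
    finally show ?case .
  qed
  then have "L1_norm v h \<le> (\<integral>\<^sup>+x. (ennreal \<bar>f x\<bar> * ennreal (v x)) * Linf_norm g \<partial>halfline)"
    unfolding L1_norm_eq by (rule nn_integral_mono_AE)
  also have "\<dots> = L1_norm v f * Linf_norm g"
    unfolding L1_norm_eq by (rule nn_integral_multc) measurable
  finally show ?thesis .
qed

lemma Linf_norm_one_le: "Linf_norm (\<lambda>_. 1) \<le> 1"
  unfolding Linf_norm_def by (rule esssup_I) auto

lemma trivial_factorization:
  assumes "h \<in> L1_space v"
  shows "factorization v h h (\<lambda>_. 1)"
  using assms le_less_trans[OF Linf_norm_one_le ennreal_one_less_top]
  by (simp add: factorization_def Linf_space_def)

lemma factorization_imp_L1_finite:
  assumes "v \<in> borel_measurable halfline" "factorization v h f g"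
  shows "L1_norm v h < \<infinity>"
proof -
  have "L1_norm v f * Linf_norm g < \<infinity>"
    using assms(2) by (simp add: factorization_def L1_space_def Linf_space_def ennreal_mult_less_top)
  then show ?thesis
    using L1_norm_le_of_factorization[OF assms] by (rule le_less_trans[rotated])
qed

text \<open>
  When \<open>L1_norm v h\<close> is infinite there is no factorization, and both sides are \<open>\<infinity>\<close> because the
  infimum of the empty set is \<open>\<infinity>\<close>.
\<close>

lemma factor_norm_eq_L1_norm:
  assumes v: "v \<in> borel_measurable halfline" and h: "h \<in> borel_measurable halfline"
  shows "factor_norm v h = L1_norm v h"
proof (rule antisym)
  show "L1_norm v h \<le> factor_norm v h"
    unfolding factor_norm_def using L1_norm_le_of_factorization[OF v]
    by (auto intro!: Inf_greatest)
  show "factor_norm v h \<le> L1_norm v h"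
  proof (cases "L1_norm v h < \<infinity>")
    case True
    then have "factorization v h h (\<lambda>_. 1)"
      using h by (intro trivial_factorization) (simp add: L1_space_def)
    then have "factor_norm v h \<le> L1_norm v h * Linf_norm (\<lambda>_. 1)"
      unfolding factor_norm_def by (intro Inf_lower) auto
    also have "\<dots> \<le> L1_norm v h"
      using mult_left_mono[OF Linf_norm_one_le, of "L1_norm v h"] by simp
    finally show ?thesis .
  qed (simp add: not_less top_unique)
qed

section \<open>The extremal constants\<close>

text \<open>Both inequalities hold at some common point \<open>t\<close> with \<open>0 < v t\<close>, which can then be divided out.\<close>

lemma m1star_bound_le_M1star_bound:
  assumes v: "weight v" and c: "m1star_bound v c" and C: "M1star_bound v C"
  shows "c \<le> C"
proof (rule ccontr)
  assume "\<not> c \<le> C"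
  have "AE t in halfline. 0 < v t" using v by (simp add: weight_def)
  moreover have "AE t in halfline. ennreal (c * v t) \<le> average v t"
    using c by (simp add: m1star_bound_def)
  moreover have "AE t in halfline. average v t \<le> ennreal (C * v t)"
    using C by (simp add: M1star_bound_def)
  ultimately have "AE t in halfline. False"
  proof eventually_elim
    case (elim t)
    have "0 < C" using C by (simp add: M1star_bound_def)
    have "ennreal (c * v t) \<le> ennreal (C * v t)"
      using elim by (meson order_trans)
    then have "c * v t \<le> C * v t"
      using elim \<open>0 < C\<close> by (simp add: ennreal_le_iff)
    then show False using elim \<open>\<not> c \<le> C\<close> by simp
  qed
  then have "emeasure halfline (space halfline) = 0"
    unfolding ae_filter_eq_bot_iff[symmetric] trivial_limit_def .
  moreover have "emeasure halfline {1..2} \<le> emeasure halfline (space halfline)"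
    by (rule emeasure_space)
  moreover have "emeasure halfline {1..2} = 1"
    by (subst emeasure_restrict_space) auto
  ultimately show False by simp
qed

text \<open>
  The infimum \<open>s\<close> is itself admissible: \<open>s + 1/(n+1)\<close> is for every \<open>n\<close>, countably many exceptional
  null sets can be merged, and \<open>s\<close> is positive since any constant from \<open>m1star\<close> is a lower bound.
\<close>

lemma M1star_const_least:
  assumes v: "weight v" and M: "v \<in> M1star" and m: "v \<in> m1star"
  shows "M1star_bound v (M1star_const v)"
    and "M1star_bound v C \<Longrightarrow> M1star_const v \<le> C"
proof -
  let ?S = "{C. M1star_bound v C}"
  define s where "s = Inf ?S"
  obtain c where c: "m1star_bound v c" using m by (auto simp: m1star_def)
  have ne: "?S \<noteq> {}" using M by (auto simp: M1star_def)
  have lower: "c \<le> C" if "C \<in> ?S" for C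
    using m1star_bound_le_M1star_bound[OF v c] that by simp
  have bdd: "bdd_below ?S" using lower by (rule bdd_belowI)
  have "c \<le> s" unfolding s_def by (rule cInf_greatest[OF ne lower])
  then have "0 < s" using c by (simp add: m1star_bound_def)
  have ae: "AE t in halfline. average v t \<le> ennreal ((s + 1 / (real n + 1)) * v t)" for n
  proof -
    have "Inf ?S < s + 1 / (real n + 1)" unfolding s_def by simp
    then obtain C where C: "C \<in> ?S" "C < s + 1 / (real n + 1)"
      using cInf_less_iff[OF ne bdd] by blast
    have "AE t in halfline. average v t \<le> ennreal (C * v t)"
      using C by (simp add: M1star_bound_def)
    moreover have "AE t in halfline. 0 < v t" using v by (simp add: weight_def)
    ultimately show ?thesis
    proof eventually_elim
      case (elim t)
      have "ennreal (C * v t) \<le> ennreal ((s + 1 / (real n + 1)) * v t)"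
        using C elim by (intro ennreal_leI mult_right_mono) auto
      then show ?case using elim by (meson order_trans)
    qed
  qed
  have "AE t in halfline. \<forall>n. average v t \<le> ennreal ((s + 1 / (real n + 1)) * v t)"
    unfolding AE_all_countable using ae by (rule allI)
  then have "AE t in halfline. average v t \<le> ennreal (s * v t)"
  proof eventually_elim
    case (elim t)
    have "(\<lambda>n. 1 / (real n + 1)) \<longlonglongrightarrow> 0"
      using LIMSEQ_inverse_real_of_nat by (simp add: inverse_eq_divide add.commute)
    then have "(\<lambda>n. ennreal ((s + 1 / (real n + 1)) * v t)) \<longlonglongrightarrow> ennreal ((s + 0) * v t)"
      by (intro tendsto_intros)
    then show ?case using elim by (intro LIMSEQ_le_const) auto
  qed
  then have s: "M1star_bound v s" using \<open>0 < s\<close> by (simp add: M1star_bound_def)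
  have le: "s \<le> C" if "M1star_bound v C" for C
    unfolding s_def using that bdd by (intro cInf_lower) auto
  have "M1star_const v = s"
    unfolding M1star_const_def using s le by (rule Least_equality)
  then show "M1star_bound v (M1star_const v)" "M1star_bound v C \<Longrightarrow> M1star_const v \<le> C"
    using s le by auto
qed

text \<open>The dual limit argument; here the upper bound that makes the supremum finite comes from
  \<open>M1star\<close>.\<close>

lemma m1star_const_greatest:
  assumes v: "weight v" and M: "v \<in> M1star" and m: "v \<in> m1star"
  shows "m1star_bound v (m1star_const v)"
    and "m1star_bound v c \<Longrightarrow> c \<le> m1star_const v"
proof -
  let ?S = "{c. m1star_bound v c}"
  define s where "s = Sup ?S"
  obtain C where C: "M1star_bound v C" using M by (auto simp: M1star_def)
  have ne: "?S \<noteq> {}" using m by (auto simp: m1star_def)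
  have upper: "c \<le> C" if "c \<in> ?S" for c
    using m1star_bound_le_M1star_bound[OF v _ C] that by simp
  have bdd: "bdd_above ?S" using upper by (rule bdd_aboveI)
  have le: "c \<le> s" if "m1star_bound v c" for c
    unfolding s_def using that bdd by (intro cSup_upper) auto
  obtain c0 where "m1star_bound v c0" using ne by auto
  then have "0 < s" using le[of c0] by (simp add: m1star_bound_def)
  have ae: "AE t in halfline. ennreal ((s - 1 / (real n + 1)) * v t) \<le> average v t" for n
  proof -
    have "s - 1 / (real n + 1) < Sup ?S" unfolding s_def by simp
    then obtain c where c: "c \<in> ?S" "s - 1 / (real n + 1) < c"
      using less_cSup_iff[OF ne bdd] by blast
    have "AE t in halfline. ennreal (c * v t) \<le> average v t"
      using c by (simp add: m1star_bound_def)
    moreover have "AE t in halfline. 0 < v t" using v by (simp add: weight_def)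
    ultimately show ?thesis
    proof eventually_elim
      case (elim t)
      have "ennreal ((s - 1 / (real n + 1)) * v t) \<le> ennreal (c * v t)"
        using c elim by (intro ennreal_leI mult_right_mono) auto
      then show ?case using elim by (meson order_trans)
    qed
  qed
  have "AE t in halfline. \<forall>n. ennreal ((s - 1 / (real n + 1)) * v t) \<le> average v t"
    unfolding AE_all_countable using ae by (rule allI)
  then have "AE t in halfline. ennreal (s * v t) \<le> average v t"
  proof eventually_elim
    case (elim t)
    have "(\<lambda>n. 1 / (real n + 1)) \<longlonglongrightarrow> 0"
      using LIMSEQ_inverse_real_of_nat by (simp add: inverse_eq_divide add.commute)
    then have "(\<lambda>n. ennreal ((s - 1 / (real n + 1)) * v t)) \<longlonglongrightarrow> ennreal ((s - 0) * v t)"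
      by (intro tendsto_intros)
    then show ?case using elim by (intro LIMSEQ_le_const2) auto
  qed
  then have s: "m1star_bound v s" using \<open>0 < s\<close> by (simp add: m1star_bound_def)
  have "m1star_const v = s"
    unfolding m1star_const_def using s le by (rule Greatest_equality)
  then show "m1star_bound v (m1star_const v)" "m1star_bound v c \<Longrightarrow> c \<le> m1star_const v"
    using s le by auto
qed

section \<open>From integral inequalities to pointwise inequalities\<close>

text \<open>
  Testing on the part of \<open>[1/(n+1), n+1]\<close> where \<open>G < F\<close>: there the integral of \<open>G\<close> is finite, so it
  would be strictly smaller than the integral of \<open>F\<close> if that part had positive measure.
\<close>

lemma AE_le_of_indicator_integrals_le:
  fixes F G :: "real \<Rightarrow> ennreal"
  assumes [measurable]: "F \<in> borel_measurable halfline" "G \<in> borel_measurable halfline"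
  assumes fin: "\<And>E n. E \<in> sets halfline \<Longrightarrow> E \<subseteq> {1 / (real n + 1)..real n + 1} \<Longrightarrow>
      (\<integral>\<^sup>+x. indicator E x * G x \<partial>halfline) < \<infinity>"
  assumes le: "\<And>E n. E \<in> sets halfline \<Longrightarrow> E \<subseteq> {1 / (real n + 1)..real n + 1} \<Longrightarrow>
      (\<integral>\<^sup>+x. indicator E x * F x \<partial>halfline) \<le> (\<integral>\<^sup>+x. indicator E x * G x \<partial>halfline)"
  shows "AE x in halfline. F x \<le> G x"
proof -
  let ?K = "\<lambda>n. {1 / (real n + 1)..real n + 1}"
  have "AE x in halfline. x \<in> ?K n \<longrightarrow> F x \<le> G x" for n
  proof -
    note Icc_inverse_nat_halfline(2)[of n, measurable]
    define E where "E = {x \<in> space halfline. G x < F x} \<inter> ?K n"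
    have E [measurable]: "E \<in> sets halfline" unfolding E_def by measurable
    have sub: "E \<subseteq> ?K n" by (auto simp: E_def)
    have "AE x in halfline. indicator E x * F x \<le> indicator E x * G x"
    proof (rule ccontr)
      assume not: "\<not> (AE x in halfline. indicator E x * F x \<le> indicator E x * G x)"
      have "(\<integral>\<^sup>+x. indicator E x * G x \<partial>halfline) < (\<integral>\<^sup>+x. indicator E x * F x \<partial>halfline)"
      proof (rule nn_integral_less[OF _ _ _ _ not])
        show "AE x in halfline. indicator E x * G x \<le> indicator E x * F x"
          by (auto simp: E_def split: split_indicator)
      qed (use fin[OF E sub] in auto)
      then show False using le[OF E sub] by simp
    qed
    moreover have "AE x in halfline. x \<in> space halfline" by (rule AE_space)
    ultimately show ?thesis
      by eventually_elim (auto simp: E_def not_less split: split_indicator_asm)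
  qed
  then have "AE x in halfline. \<forall>n. x \<in> ?K n \<longrightarrow> F x \<le> G x"
    unfolding AE_all_countable by (rule allI)
  moreover have "AE x in halfline. x \<in> space halfline" by (rule AE_space)
  ultimately show ?thesis
  proof eventually_elim
    case (elim x)
    then obtain n where "x \<in> ?K n" using halfline_exhaustion[of x] by auto
    then show ?case using elim by blast
  qed
qed

lemma L1_norm_indicator_finite:
  assumes v: "weight v" and E: "E \<in> sets halfline" "E \<subseteq> {1 / (real n + 1)..real n + 1}"
  shows "L1_norm v (indicator E) < \<infinity>"
proof -
  let ?K = "{1 / (real n + 1)..real n + 1}"
  have "set_integrable lebesgue ?K v"
    using v Icc_inverse_nat_halfline(1)[of n] by (auto simp: weight_def)
  then have "(\<integral>\<^sup>+x. ennreal (norm (indicator ?K x *\<^sub>R v x)) \<partial>lebesgue) < \<infinity>"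
    unfolding set_integrable_def by (simp add: integrable_iff_bounded)
  moreover have "L1_norm v (indicator E) \<le> (\<integral>\<^sup>+x. ennreal (norm (indicator ?K x *\<^sub>R v x)) \<partial>lebesgue)"
  proof -
    have "ennreal (\<bar>indicator E x\<bar> * v x) * indicator {0<..} x
        \<le> ennreal (norm (indicator ?K x *\<^sub>R v x))" for x
    proof (cases "x \<in> E")
      case True
      then have "x \<in> ?K" using E(2) by (rule subsetD[rotated])
      then show ?thesis using True
        by (auto simp: indicator_def abs_ge_self)
    qed simp
    then show ?thesis
      unfolding L1_norm_def by (subst nn_integral_restrict_space) (simp_all add: nn_integral_mono)
  qed
  ultimately show ?thesis by (rule le_less_trans[rotated])
qed

section \<open>Comparison of the norms\<close>

lemma Cop1_norm_le_L1_norm: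
  assumes "v \<in> borel_measurable halfline" "h \<in> borel_measurable halfline" "M1star_bound v C"
  shows "Cop1_norm v h \<le> ennreal C * L1_norm v h"
proof -
  note [measurable] = assms(1,2)
  have "0 < C" using assms(3) by (simp add: M1star_bound_def)
  have "AE x in halfline. average v x \<le> ennreal (C * v x)"
    using assms(3) by (simp add: M1star_bound_def)
  then have "AE x in halfline.
      ennreal \<bar>h x\<bar> * average v x \<le> ennreal C * (ennreal \<bar>h x\<bar> * ennreal (v x))"
  proof eventually_elim
    case (elim x)
    then have "ennreal \<bar>h x\<bar> * average v x \<le> ennreal \<bar>h x\<bar> * ennreal (C * v x)"
      by (rule mult_left_mono) simp
    then show ?case using \<open>0 < C\<close> by (simp add: ennreal_mult' mult_ac)
  qed
  then have "Cop1_norm v h \<le> (\<integral>\<^sup>+x. ennreal C * (ennreal \<bar>h x\<bar> * ennreal (v x)) \<partial>halfline)"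
    unfolding Cop1_norm_eq_average[OF assms(1,2)] by (rule nn_integral_mono_AE)
  also have "\<dots> = ennreal C * L1_norm v h"
    unfolding L1_norm_eq by (rule nn_integral_cmult) measurable
  finally show ?thesis .
qed

lemma L1_norm_le_Cop1_norm:
  assumes "v \<in> borel_measurable halfline" "h \<in> borel_measurable halfline" "m1star_bound v c"
  shows "ennreal c * L1_norm v h \<le> Cop1_norm v h"
proof -
  note [measurable] = assms(1,2)
  have "0 < c" using assms(3) by (simp add: m1star_bound_def)
  have "AE x in halfline. ennreal (c * v x) \<le> average v x"
    using assms(3) by (simp add: m1star_bound_def)
  then have "AE x in halfline.
      ennreal c * (ennreal \<bar>h x\<bar> * ennreal (v x)) \<le> ennreal \<bar>h x\<bar> * average v x"
  proof eventually_elim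
    case (elim x)
    then have "ennreal \<bar>h x\<bar> * ennreal (c * v x) \<le> ennreal \<bar>h x\<bar> * average v x"
      by (rule mult_left_mono) simp
    then show ?case using \<open>0 < c\<close> by (simp add: ennreal_mult' mult_ac)
  qed
  then have "(\<integral>\<^sup>+x. ennreal c * (ennreal \<bar>h x\<bar> * ennreal (v x)) \<partial>halfline) \<le> Cop1_norm v h"
    unfolding Cop1_norm_eq_average[OF assms(1,2)] by (rule nn_integral_mono_AE)
  moreover have "(\<integral>\<^sup>+x. ennreal c * (ennreal \<bar>h x\<bar> * ennreal (v x)) \<partial>halfline)
      = ennreal c * L1_norm v h"
    unfolding L1_norm_eq by (rule nn_integral_cmult) measurable
  ultimately show ?thesis by simp
qed

lemma Cop1_norm_indicator_finite:
  assumes "weight v" "v \<in> M1star" "E \<in> sets halfline" "E \<subseteq> {1 / (real n + 1)..real n + 1}"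
  shows "Cop1_norm v (indicator E) < \<infinity>"
proof -
  obtain C where C: "M1star_bound v C" using assms(2) by (auto simp: M1star_def)
  have "Cop1_norm v (indicator E) \<le> ennreal C * L1_norm v (indicator E)"
    using assms C by (intro Cop1_norm_le_L1_norm) (auto simp: weight_def)
  also have "\<dots> < \<infinity>"
    using L1_norm_indicator_finite[OF assms(1,3,4)] by (simp add: ennreal_mult_less_top)
  finally show ?thesis .
qed

lemma Cop1_norm_indicator:
  assumes "v \<in> borel_measurable halfline" "E \<in> sets halfline"
  shows "Cop1_norm v (indicator E) = (\<integral>\<^sup>+x. indicator E x * average v x \<partial>halfline)"
  using assms by (subst Cop1_norm_eq_average) (auto intro!: nn_integral_cong split: split_indicator)

lemma L1_norm_indicator:
  assumes "v \<in> borel_measurable halfline" "E \<in> sets halfline" "0 \<le> c"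
  shows "ennreal c * L1_norm v (indicator E) =
    (\<integral>\<^sup>+x. indicator E x * ennreal (c * v x) \<partial>halfline)"
  unfolding L1_norm_eq using assms
  by (subst nn_integral_cmult[symmetric])
     (auto intro!: nn_integral_cong simp: ennreal_mult' split: split_indicator)

text \<open>
  The norm inequalities determine the pointwise ones, since on indicator functions both norms are
  integrals over the set, of \<open>v\<close> and of its average, and both are finite on sets bounded away from
  \<open>0\<close> and \<open>\<infinity>\<close>.
\<close>

lemma m1star_bound_of_norm_le:
  assumes v: "weight v" "v \<in> M1star" and c: "0 < c"
    and le: "\<And>h. h \<in> Cop1 v \<Longrightarrow> ennreal c * L1_norm v h \<le> Cop1_norm v h"
  shows "m1star_bound v c"
proof -
  have vm [measurable]: "v \<in> borel_measurable halfline" using v by (simp add: weight_def)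
  have "AE x in halfline. ennreal (c * v x) \<le> average v x"
  proof (rule AE_le_of_indicator_integrals_le)
    fix E n assume E: "E \<in> sets halfline" "E \<subseteq> {1 / (real n + 1)..real n + 1}"
    have fin: "Cop1_norm v (indicator E) < \<infinity>"
      by (rule Cop1_norm_indicator_finite[OF v E])
    then show "(\<integral>\<^sup>+x. indicator E x * average v x \<partial>halfline) < \<infinity>"
      by (simp add: Cop1_norm_indicator[OF vm E(1)])
    have "indicator E \<in> Cop1 v"
      using fin E(1) by (simp add: Cop1_def)
    from le[OF this] show "(\<integral>\<^sup>+x. indicator E x * ennreal (c * v x) \<partial>halfline)
        \<le> (\<integral>\<^sup>+x. indicator E x * average v x \<partial>halfline)"
      using c by (simp add: Cop1_norm_indicator[OF vm E(1)] L1_norm_indicator[OF vm E(1)])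
  qed measurable
  then show ?thesis using c by (simp add: m1star_bound_def)
qed

lemma M1star_bound_of_norm_le:
  assumes v: "weight v" "v \<in> M1star" and c: "0 < c"
    and le: "\<And>h. h \<in> Cop1 v \<Longrightarrow> Cop1_norm v h \<le> ennreal c * L1_norm v h"
  shows "M1star_bound v c"
proof -
  have vm [measurable]: "v \<in> borel_measurable halfline" using v by (simp add: weight_def)
  have "AE x in halfline. average v x \<le> ennreal (c * v x)"
  proof (rule AE_le_of_indicator_integrals_le)
    fix E n assume E: "E \<in> sets halfline" "E \<subseteq> {1 / (real n + 1)..real n + 1}"
    have "ennreal c * L1_norm v (indicator E) < \<infinity>"
      using L1_norm_indicator_finite[OF v(1) E] by (simp add: ennreal_mult_less_top)
    then show "(\<integral>\<^sup>+x. indicator E x * ennreal (c * v x) \<partial>halfline) < \<infinity>"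
      using c by (simp add: L1_norm_indicator[OF vm E(1)])
    have "indicator E \<in> Cop1 v"
      using Cop1_norm_indicator_finite[OF v E] E(1) by (simp add: Cop1_def)
    from le[OF this] show "(\<integral>\<^sup>+x. indicator E x * average v x \<partial>halfline)
        \<le> (\<integral>\<^sup>+x. indicator E x * ennreal (c * v x) \<partial>halfline)"
      using c by (simp add: Cop1_norm_indicator[OF vm E(1)] L1_norm_indicator[OF vm E(1)])
  qed measurable
  then show ?thesis using c by (simp add: M1star_bound_def)
qed

theorem theorem4p3:
  fixes v :: "real \<Rightarrow> real"
  assumes "weight v" and "v \<in> M1star" and "v \<in> m1star"
  shows "(\<forall>h \<in> borel_measurable halfline. h \<in> Cop1 v \<longleftrightarrow> (\<exists>f g. factorization v h f g)) \<and>
    (\<forall>h \<in> Cop1 v.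
       ennreal (m1star_const v) * factor_norm v h \<le> Cop1_norm v h \<and>
       Cop1_norm v h \<le> ennreal (M1star_const v) * factor_norm v h) \<and>
    (\<forall>c > m1star_const v. \<not> (\<forall>h \<in> Cop1 v. ennreal c * factor_norm v h \<le> Cop1_norm v h)) \<and>
    (\<forall>c < M1star_const v. \<not> (\<forall>h \<in> Cop1 v. Cop1_norm v h \<le> ennreal c * factor_norm v h))"
proof (intro conjI ballI allI impI)
  have v: "v \<in> borel_measurable halfline" using assms(1) by (simp add: weight_def)
  note M = M1star_const_least[OF assms] and m = m1star_const_greatest[OF assms]
  have M_pos: "0 < M1star_const v" using M(1) by (simp add: M1star_bound_def)
  have m_pos: "0 < m1star_const v" using m(1) by (simp add: m1star_bound_def)
  have norm: "factor_norm v h = L1_norm v h" if "h \<in> Cop1 v" for h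
    using that v by (intro factor_norm_eq_L1_norm) (auto simp: Cop1_def)
  {
    fix h :: "real \<Rightarrow> real" assume h: "h \<in> borel_measurable halfline"
    show "h \<in> Cop1 v \<longleftrightarrow> (\<exists>f g. factorization v h f g)"
    proof
      assume "h \<in> Cop1 v"
      then have "ennreal (m1star_const v) * L1_norm v h < \<infinity>"
        using L1_norm_le_Cop1_norm[OF v h m(1)] by (auto simp: Cop1_def intro: le_less_trans)
      then have "L1_norm v h < \<infinity>"
        using m_pos by (auto simp: ennreal_mult_less_top ennreal_eq_0_iff)
      then show "\<exists>f g. factorization v h f g"
        using h trivial_factorization[of h v] by (auto simp: L1_space_def)
    next
      assume "\<exists>f g. factorization v h f g"
      then have "L1_norm v h < \<infinity>" using factorization_imp_L1_finite[OF v] by blast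
      then have "ennreal (M1star_const v) * L1_norm v h < \<infinity>"
        by (simp add: ennreal_mult_less_top)
      then have "Cop1_norm v h < \<infinity>"
        using Cop1_norm_le_L1_norm[OF v h M(1)] by (rule le_less_trans[rotated])
      then show "h \<in> Cop1 v" using h by (simp add: Cop1_def)
    qed
  next
    fix h :: "real \<Rightarrow> real" assume h: "h \<in> Cop1 v"
    then have "h \<in> borel_measurable halfline" by (simp add: Cop1_def)
    then show "ennreal (m1star_const v) * factor_norm v h \<le> Cop1_norm v h"
        "Cop1_norm v h \<le> ennreal (M1star_const v) * factor_norm v h"
      unfolding norm[OF h]
      using L1_norm_le_Cop1_norm[OF v _ m(1)] Cop1_norm_le_L1_norm[OF v _ M(1)] by auto
  next
    fix c assume c: "m1star_const v < c"
    show "\<not> (\<forall>h \<in> Cop1 v. ennreal c * factor_norm v h \<le> Cop1_norm v h)"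
    proof
      assume "\<forall>h \<in> Cop1 v. ennreal c * factor_norm v h \<le> Cop1_norm v h"
      then have "m1star_bound v c"
        using c m_pos norm by (intro m1star_bound_of_norm_le[OF assms(1,2)]) auto
      then show False using m(2) c by force
    qed
  next
    fix c assume c: "c < M1star_const v"
    show "\<not> (\<forall>h \<in> Cop1 v. Cop1_norm v h \<le> ennreal c * factor_norm v h)"
    proof
      assume le: "\<forall>h \<in> Cop1 v. Cop1_norm v h \<le> ennreal c * factor_norm v h"
      \<comment> \<open>An admissible constant must be positive, whereas \<open>c\<close> need not be; any positive number
        between \<open>c\<close> and the least constant serves instead.\<close>
      define d where "d = max c (M1star_const v / 2)"
      have d: "0 < d" "d < M1star_const v" "c \<le> d"
        using c M_pos by (auto simp: d_def)
      have "Cop1_norm v h \<le> ennreal d * L1_norm v h" if "h \<in> Cop1 v" for h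
      proof -
        have "Cop1_norm v h \<le> ennreal c * L1_norm v h"
          using le norm that by auto
        also have "\<dots> \<le> ennreal d * L1_norm v h"
          using d by (intro mult_right_mono ennreal_leI) auto
        finally show ?thesis .
      qed
      then have "M1star_bound v d"
        using d by (intro M1star_bound_of_norm_le[OF assms(1,2)]) auto
      then show False using M(2) d by force
    qed
  }
qed

end
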